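(* Let $k\ge 1$ and $p_1,p_2\geq k$ be integers, and let $K_{p_1}\circ_{k}K_{p_2}$ be the $k$-coalescence of the complete graphs $K_{p_1}$ and $K_{p_2}$, which has $t=p_1+p_2-k$ vertices. Let $T$ be the set of $k$ vertices of $K_{p_1}\circ_{k}K_{p_2}$ obtained by identifying vertices of $K_{p_1}$ with vertices of $K_{p_2}$. Write $r_{ij}$ for the resistance distance between vertices $v_i$ and $v_j$ of $K_{p_1}\circ_{k}K_{p_2}$. Then: (i) for any distinct $v_i, v_j\in T$, $r_{ij}= \frac{2}{t}$; (ii) for $v_i\in T$, $v_j\in V(K_{p_1})\setminus T$, $r_{ij}= \frac{(k+1)(p_2-k)+2p_1k}{kp_1t}$; (iii) for $v_i\in T$, $v_j\in V(K_{p_2})\setminus T$, $r_{ij}= \frac{(k+1)(p_1-k)+2p_2k}{kp_2t}$; (iv) for any distinct $v_i, v_j\in V(K_{p_1})\setminus T$, $r_{ij}= \frac{2}{p_1}$; (v) for $v_i\in V(K_{p_1})\setminus T$, $v_j\in V(K_{p_2})\setminus T$, $r_{ij}= \frac{(p_1+p_2)(k+1)}{kp_1p_2}$; (vi) for any distinct $v_i, v_j\in V(K_{p_2})\setminus T$, $r_{ij}= \frac{2}{p_2}$.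
   Context: All graphs are simple, connected and undirected. The resistance distance $r_{ij}$ between vertices $v_i,v_j$ of a graph is the effective resistance between them when every edge is a resistor of $1\Omega$; equivalently $r_{ij}=l^{\#}_{ii}+l^{\#}_{jj}-2l^{\#}_{ij}$, where $(l^{\#}_{ij})$ is the group inverse of the Laplacian matrix $L=D-A$. For two graphs $G$, $G'$ each containing an induced complete subgraph $K_k$, the $k$-coalescence $G\circ_k G'$ is the graph obtained by identifying the $k$ vertices of an induced $K_k$ in $G$ with the $k$ vertices of an induced $K_k$ in $G'$ (the $\binom{k}{2}$ edges among them being identified as well); it has $|V(G)|+|V(G')|-k$ vertices and $|E(G)|+|E(G')|-\binom{k}{2}$ edges. Here $K_{p_1}\circ_k K_{p_2}$ is obtained by identifying $k$ vertices of $K_{p_1}$ with $k$ vertices of $K_{p_2}$. *)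

theory Defs
  imports Complex_Main "Graph_Theory.Graph_Theory"
begin

text \<open>
  As in the library, an undirected graph is a symmetric digraph (locale \<^locale>\<open>graph\<close>), each
  edge being a pair of opposite arcs.
\<close>

section \<open>Resistance distance\<close>

text \<open>
  A matrix with rows and columns indexed by a finite set \<open>V\<close> is a function of two arguments of
  which only the values on \<open>V\<close> matter.
\<close>

definition matmul_on :: "'a set \<Rightarrow> ('a \<Rightarrow> 'a \<Rightarrow> real) \<Rightarrow> ('a \<Rightarrow> 'a \<Rightarrow> real) \<Rightarrow> 'a \<Rightarrow> 'a \<Rightarrow> real" where
  "matmul_on V A B = (\<lambda>u w. \<Sum>v\<in>V. A u v * B v w)"

text \<open>
  The first conjunct only fixes the irrelevant values of \<open>X\<close> outside of \<open>V\<close>, so that \<open>X\<close> is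
  unique as a function.
\<close>

definition is_group_inverse :: "'a set \<Rightarrow> ('a \<Rightarrow> 'a \<Rightarrow> real) \<Rightarrow> ('a \<Rightarrow> 'a \<Rightarrow> real) \<Rightarrow> bool" where
  "is_group_inverse V A X \<longleftrightarrow>
     (\<forall>u v. u \<notin> V \<or> v \<notin> V \<longrightarrow> X u v = 0) \<and>
     (\<forall>u\<in>V. \<forall>v\<in>V.
        matmul_on V (matmul_on V A X) A u v = A u v \<and>
        matmul_on V (matmul_on V X A) X u v = X u v \<and>
        matmul_on V A X u v = matmul_on V X A u v)"

definition group_inverse :: "'a set \<Rightarrow> ('a \<Rightarrow> 'a \<Rightarrow> real) \<Rightarrow> 'a \<Rightarrow> 'a \<Rightarrow> real" where
  "group_inverse V A = (THE X. is_group_inverse V A X)"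

definition laplacian :: "('a, 'b) pre_digraph \<Rightarrow> 'a \<Rightarrow> 'a \<Rightarrow> real" where
  "laplacian G u v =
     (if u = v then real (out_degree G u) else 0) - (if u \<rightarrow>\<^bsub>G\<^esub> v then 1 else 0)"

definition resistance_distance :: "('a, 'b) pre_digraph \<Rightarrow> 'a \<Rightarrow> 'a \<Rightarrow> real" where
  "resistance_distance G u v =
     (let X = group_inverse (verts G) (laplacian G) in X u u + X v v - 2 * X u v)"

lemma matmul_on_cong:
  "(\<And>w. w \<in> V \<Longrightarrow> A u w = A' u w) \<Longrightarrow> (\<And>w. w \<in> V \<Longrightarrow> B w v = B' w v) \<Longrightarrow>
    matmul_on V A B u v = matmul_on V A' B' u v"
  by (simp add: matmul_on_def)

lemma matmul_on_assoc:
  "finite V \<Longrightarrow> matmul_on V (matmul_on V A B) C = matmul_on V A (matmul_on V B C)"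
proof (intro ext)
  fix u w assume "finite V"
  have "matmul_on V (matmul_on V A B) C u w = (\<Sum>y\<in>V. \<Sum>x\<in>V. A u x * B x y * C y w)"
    by (simp add: matmul_on_def sum_distrib_right)
  also have "\<dots> = (\<Sum>x\<in>V. \<Sum>y\<in>V. A u x * B x y * C y w)"
    by (rule sum.swap)
  also have "\<dots> = matmul_on V A (matmul_on V B C) u w"
    by (simp add: matmul_on_def sum_distrib_left mult.assoc)
  finally show "matmul_on V (matmul_on V A B) C u w = matmul_on V A (matmul_on V B C) u w" .
qed

lemma is_group_inverse_unique:
  assumes V: "finite V" and X: "is_group_inverse V A X" and Y: "is_group_inverse V A Y"
  shows "X = Y"
proof -
  define B where "B = (\<lambda>u v. if u \<in> V \<and> v \<in> V then A u v else 0)"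
  let ?M = "matmul_on V"
  have supp: "?M C D u v = 0"
    if "\<And>u v. u \<notin> V \<or> v \<notin> V \<Longrightarrow> C u v = 0" "\<And>u v. u \<notin> V \<or> v \<notin> V \<Longrightarrow> D u v = 0"
      "u \<notin> V \<or> v \<notin> V" for C D :: "'a \<Rightarrow> 'a \<Rightarrow> real" and u v
    using that by (auto simp: matmul_on_def)
  have B0: "B u v = 0" if "u \<notin> V \<or> v \<notin> V" for u v
    using that by (auto simp: B_def)
  have eqs: "?M (?M B Z) B = B" "?M (?M Z B) Z = Z" "?M B Z = ?M Z B"
    if Z: "is_group_inverse V A Z" for Z
  proof -
    have Z0: "Z u v = 0" if "u \<notin> V \<or> v \<notin> V" for u v
      using Z that by (auto simp: is_group_inverse_def)
    have AB: "?M B Z u v = ?M A Z u v" "?M Z B u v = ?M Z A u v"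
      if "u \<in> V" "v \<in> V" for u v
      using that by (auto simp: matmul_on_def B_def intro!: sum.cong)
    have AB3: "?M (?M B Z) B u v = ?M (?M A Z) A u v" "?M (?M Z B) Z u v = ?M (?M Z A) Z u v"
      if uv: "u \<in> V" "v \<in> V" for u v
      by (rule matmul_on_cong; use uv in \<open>simp add: AB B_def\<close>)+
    show "?M (?M B Z) B = B"
    proof (intro ext)
      fix u v show "?M (?M B Z) B u v = B u v"
        using Z AB3[of u v] supp[of "?M B Z" B u v] supp[of B Z] B0 Z0
        by (cases "u \<in> V \<and> v \<in> V") (auto simp: is_group_inverse_def B_def)
    qed
    show "?M (?M Z B) Z = Z"
    proof (intro ext)
      fix u v show "?M (?M Z B) Z u v = Z u v"
        using Z AB3[of u v] supp[of "?M Z B" Z u v] supp[of Z B] B0 Z0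
        by (cases "u \<in> V \<and> v \<in> V") (auto simp: is_group_inverse_def)
    qed
    show "?M B Z = ?M Z B"
    proof (intro ext)
      fix u v show "?M B Z u v = ?M Z B u v"
        using Z AB[of u v] supp[of Z B u v] supp[of B Z u v] B0 Z0
        by (cases "u \<in> V \<and> v \<in> V") (auto simp: is_group_inverse_def)
    qed
  qed
  note x = eqs[OF X] and y = eqs[OF Y] and assoc = matmul_on_assoc[OF V]
  have "?M B X = ?M (?M (?M B Y) B) X" by (simp only: y(1))
  also have "\<dots> = ?M (?M B Y) (?M B X)" by (simp only: assoc)
  also have "\<dots> = ?M (?M Y B) (?M X B)" by (simp only: x(3) y(3))
  also have "\<dots> = ?M Y (?M (?M B X) B)" by (simp only: assoc)
  also have "\<dots> = ?M B Y" by (simp only: x(1) y(3))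
  finally have BXY: "?M B X = ?M B Y" .
  have "X = ?M (?M X B) X" by (simp only: x(2))
  also have "\<dots> = ?M X (?M B Y)" by (simp only: assoc BXY)
  also have "\<dots> = ?M (?M B X) Y" by (simp only: assoc[symmetric] x(3))
  also have "\<dots> = ?M (?M Y B) Y" by (simp only: BXY y(3))
  also have "\<dots> = Y" by (rule y(2))
  finally show ?thesis .
qed

lemma group_inverse_eqI: "finite V \<Longrightarrow> is_group_inverse V A X \<Longrightarrow> group_inverse V A = X"
  unfolding group_inverse_def by (rule the_equality) (auto intro: is_group_inverse_unique)

lemma (in graph) laplacian_apply:
  assumes "u \<in> verts G"
  shows "(\<Sum>v\<in>verts G. laplacian G u v * x v) = (\<Sum>v | u \<rightarrow>\<^bsub>G\<^esub> v. x u - x v)"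
proof -
  have N: "{v. u \<rightarrow> v} \<subseteq> verts G" by (auto dest: adj_in_verts)
  have "{v. u \<rightarrow> v} = head G ` out_arcs G u"
    by (auto simp: arcs_ends_conv)
  moreover have "inj_on (head G) (out_arcs G u)"
    by (auto intro!: inj_onI no_multi_arcs simp: arc_to_ends_def)
  ultimately have deg: "card {v. u \<rightarrow> v} = out_degree G u"
    by (simp add: out_degree_def card_image)
  have "(\<Sum>v\<in>verts G. laplacian G u v * x v) =
    (\<Sum>v\<in>verts G. if u = v then real (out_degree G u) * x v else 0)
    - (\<Sum>v\<in>verts G. if u \<rightarrow> v then x v else 0)"
    unfolding sum_subtractf[symmetric] by (rule sum.cong) (auto simp: laplacian_def algebra_simps)
  also have "(\<Sum>v\<in>verts G. if u = v then real (out_degree G u) * x v else 0) = real (out_degree G u) * x u"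
    using assms by simp
  also have "(\<Sum>v\<in>verts G. if u \<rightarrow> v then x v else 0) = (\<Sum>v | u \<rightarrow> v. x v)"
    using N by (intro sum.mono_neutral_cong_right) auto
  finally show ?thesis by (simp add: sum_subtractf deg)
qed

lemma (in graph) laplacian_sym: "laplacian G u v = laplacian G v u"
  by (auto simp: laplacian_def dest: arcs_ends_symmetric[OF sym_arcs])

lemma (in graph) laplacian_kernel_constant:
  assumes conn: "connected G" and harm: "\<And>u. u \<in> verts G \<Longrightarrow> (\<Sum>v\<in>verts G. laplacian G u v * x v) = 0"
    and "a \<in> verts G" "b \<in> verts G"
  shows "x a = x b"
proof -
  define m where "m = Max (x ` verts G)"
  have ne: "verts G \<noteq> {}" using assms by auto
  have le: "x v \<le> m" if "v \<in> verts G" for v unfolding m_def using that by auto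
  obtain c where c: "c \<in> verts G" "x c = m"
    using Max_in[of "x ` verts G"] ne unfolding m_def by fastforce
  have step: "x v = m" if "u \<rightarrow> v" "x u = m" for u v
  proof -
    have u: "u \<in> verts G" using that by (auto dest: adj_in_verts)
    have N: "{v. u \<rightarrow> v} \<subseteq> verts G" by (auto dest: adj_in_verts)
    have "(\<Sum>v | u \<rightarrow> v. x u - x v) = 0" using harm[OF u] laplacian_apply[OF u, of x] by simp
    moreover have "finite {v. u \<rightarrow> v}" using N by (rule finite_subset) simp
    ultimately have "\<forall>v\<in>{v. u \<rightarrow> v}. x u - x v = 0"
      using N le that(2) by (subst (asm) sum_nonneg_eq_0_iff) auto
    then show ?thesis using that by auto
  qed
  have all: "x v = m" if "v \<in> verts G" for v
  proof -
    have "c \<rightarrow>\<^sup>* v" using symmetric_connected_imp_strongly_connected[OF sym_arcs conn] c(1) that by blast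
    then show ?thesis
      by (induct rule: reachable_induct) (auto simp: c step)
  qed
  show ?thesis using all assms by simp
qed

text \<open>
  Agreement with the effective resistance: if \<open>x\<close> is a potential for which, by Ohm's and
  Kirchhoff's laws, a unit current enters at \<open>a\<close> and leaves at \<open>b\<close>, then the resistance distance
  is the potential difference between \<open>a\<close> and \<open>b\<close>.
\<close>

lemma (in graph) resistance_distance_eq_potential_difference:
  assumes conn: "connected G" and X: "is_group_inverse (verts G) (laplacian G) X"
    and ab: "a \<in> verts G" "b \<in> verts G"
    and x: "\<And>u. u \<in> verts G \<Longrightarrow>
      (\<Sum>v | u \<rightarrow>\<^bsub>G\<^esub> v. x u - x v) = (if u = a then 1 else 0) - (if u = b then 1 else 0)"
  shows "resistance_distance G a b = x a - x b"
proof -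
  let ?V = "verts G" and ?L = "laplacian G"
  let ?M = "matmul_on ?V"
  have fin: "finite ?V" by simp
  define s :: "'a \<Rightarrow> real" where "s = (\<lambda>u. (if u = a then 1 else 0) - (if u = b then 1 else 0))"
  define C :: "'a \<Rightarrow> 'a \<Rightarrow> real" where "C = (\<lambda>u _. x u)"
  define y where "y = (\<lambda>u. X u a - X u b)"
  have LC: "?M ?L C u c = s u" if "u \<in> ?V" for u c
    using x[OF that] laplacian_apply[OF that, of x] by (simp add: matmul_on_def C_def s_def)
  have XLC: "?M X (?M ?L C) u c = y u" for u c
  proof -
    have "?M X (?M ?L C) u c = (\<Sum>v\<in>?V. X u v * s v)"
      by (subst matmul_on_def) (simp add: LC)
    also have "\<dots> = (\<Sum>v\<in>?V. if v = a then X u v else 0) - (\<Sum>v\<in>?V. if v = b then X u v else 0)"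
      unfolding sum_subtractf[symmetric] by (rule sum.cong) (auto simp: s_def)
    also have "\<dots> = y u" using ab by (simp add: y_def)
    finally show ?thesis .
  qed
  have Ly: "(\<Sum>v\<in>?V. ?L u v * y v) = s u" if u: "u \<in> ?V" for u
  proof -
    have "(\<Sum>v\<in>?V. ?L u v * y v) = ?M ?L (?M X (?M ?L C)) u u"
      by (simp add: matmul_on_def[of _ ?L "matmul_on _ X _"] XLC)
    also have "\<dots> = ?M (?M (?M ?L X) ?L) C u u"
      by (simp add: matmul_on_assoc[OF fin])
    also have "\<dots> = ?M ?L C u u"
      by (rule matmul_on_cong) (use X u in \<open>auto simp: is_group_inverse_def\<close>)
    finally show ?thesis using LC[OF u] by simp
  qed
  have "x a - y a = x b - y b"
  proof (rule laplacian_kernel_constant[OF conn _ ab, of "\<lambda>u. x u - y u"])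
    fix u assume u: "u \<in> ?V"
    have "(\<Sum>v\<in>?V. ?L u v * x v) = s u"
      using LC[OF u, of u] by (simp add: matmul_on_def C_def)
    then show "(\<Sum>v\<in>?V. ?L u v * (x v - y v)) = 0"
      using Ly[OF u] by (simp add: right_diff_distrib sum_subtractf)
  qed
  moreover have "X a b = X b a"
  proof -
    have tr: "?M (\<lambda>u v. B v u) (\<lambda>u v. C v u) = (\<lambda>u v. ?M C B v u)" for B C :: "'a \<Rightarrow> 'a \<Rightarrow> real"
      by (intro ext) (simp add: matmul_on_def mult.commute)
    have L: "?L = (\<lambda>u v. ?L v u)" by (intro ext) (rule laplacian_sym)
    define Xt where "Xt = (\<lambda>u v. X v u)"
    have eq1: "?M ?L Xt = (\<lambda>u v. ?M X ?L v u)"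
      unfolding Xt_def by (subst L) (rule tr)
    have eq2: "?M Xt ?L = (\<lambda>u v. ?M ?L X v u)"
      unfolding Xt_def by (subst L) (rule tr)
    have eq3: "?M (?M ?L Xt) ?L = (\<lambda>u v. ?M (?M ?L X) ?L v u)"
      unfolding eq1 matmul_on_assoc[OF fin, of ?L X ?L] by (subst (2) L) (rule tr)
    have eq4: "?M (?M Xt ?L) Xt = (\<lambda>u v. ?M (?M X ?L) X v u)"
      unfolding eq2 matmul_on_assoc[OF fin, of X ?L X] by (subst Xt_def) (rule tr)
    have "is_group_inverse ?V ?L Xt"
      unfolding is_group_inverse_def
    proof (intro conjI allI ballI impI)
      fix u v assume "u \<notin> ?V \<or> v \<notin> ?V"
      then show "Xt u v = 0" using X by (auto simp: is_group_inverse_def Xt_def)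
    next
      fix u v assume uv: "u \<in> ?V" "v \<in> ?V"
      show "?M (?M ?L Xt) ?L u v = ?L u v"
        unfolding eq3 using X uv laplacian_sym[of u v] by (simp add: is_group_inverse_def)
      show "?M (?M Xt ?L) Xt u v = Xt u v"
        unfolding eq4 using X uv by (simp add: is_group_inverse_def Xt_def)
      show "?M ?L Xt u v = ?M Xt ?L u v"
        unfolding eq1 eq2 using X uv by (simp add: is_group_inverse_def)
    qed
    from is_group_inverse_unique[OF fin this X] show ?thesis by (metis Xt_def)
  qed
  ultimately show ?thesis
    by (simp add: resistance_distance_def group_inverse_eqI[OF fin X] y_def)
qed

section \<open>Coalescence\<close>

text \<open>
  \<open>f\<close> matches the vertices \<open>S\<close> of an induced complete subgraph on \<open>k\<close> vertices of \<open>G\<close> with those of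
  an induced complete subgraph on \<open>k\<close> vertices of \<open>G'\<close>.
\<close>

definition clique_matching ::
  "nat \<Rightarrow> 'a pair_pre_digraph \<Rightarrow> 'b pair_pre_digraph \<Rightarrow> 'a set \<Rightarrow> ('a \<Rightarrow> 'b) \<Rightarrow> bool" where
  "clique_matching k G G' S f \<longleftrightarrow>
     S \<subseteq> pverts G \<and> f ` S \<subseteq> pverts G' \<and> inj_on f S \<and>
     K\<^bsub>k\<^esub> (with_proj G \<restriction> S) \<and> K\<^bsub>k\<^esub> (with_proj G' \<restriction> (f ` S))"

text \<open>
  In the disjoint union of the two graphs, each \<open>f s\<close> with \<open>s \<in> S\<close> is identified with \<open>s\<close>; the merged
  vertex is represented by \<open>Inl s\<close>, and \<open>glue S f\<close> embeds the vertices of the second graph.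
\<close>

definition glue :: "'a set \<Rightarrow> ('a \<Rightarrow> 'b) \<Rightarrow> 'b \<Rightarrow> 'a + 'b" where
  "glue S f y = (if y \<in> f ` S then Inl (the_inv_into S f y) else Inr y)"

definition coalescence ::
  "'a pair_pre_digraph \<Rightarrow> 'b pair_pre_digraph \<Rightarrow> 'a set \<Rightarrow> ('a \<Rightarrow> 'b) \<Rightarrow> ('a + 'b) pair_pre_digraph" where
  "coalescence G G' S f =
     \<lparr> pverts = Inl ` pverts G \<union> glue S f ` pverts G',
       parcs = map_prod Inl Inl ` parcs G \<union> map_prod (glue S f) (glue S f) ` parcs G' \<rparr>"

lemma inj_on_glue:
  assumes "inj_on f S"
  shows "inj_on (glue S f) A"
proof (rule inj_onI)
  fix x y assume eq: "glue S f x = glue S f y"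
  show "x = y"
  proof (cases "x \<in> f ` S \<and> y \<in> f ` S")
    case True
    with eq have "the_inv_into S f x = the_inv_into S f y" by (simp add: glue_def)
    then show ?thesis using True f_the_inv_into_f[OF assms] by metis
  next
    case False
    with eq show ?thesis by (simp add: glue_def split: if_splits)
  qed
qed

lemma pair_graph_coalescence:
  assumes "pair_graph G" "pair_graph G'" "inj_on f S"
  shows "pair_graph (coalescence G G' S f)"
proof -
  interpret G: pair_graph G by fact
  interpret G': pair_graph G' by fact
  have inj: "glue S f u = glue S f v \<longleftrightarrow> u = v" for u v
    using inj_on_glue[OF assms(3), of UNIV] by (simp add: inj_eq)
  have sym: "(v, u) \<in> parcs G" if "(u, v) \<in> parcs G" for u v
    using that arcs_ends_symmetric[OF G.sym_arcs] by simp
  have sym': "(v, u) \<in> parcs G'" if "(u, v) \<in> parcs G'" for u v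
    using that arcs_ends_symmetric[OF G'.sym_arcs] by simp
  show ?thesis
  proof
    show "symmetric (with_proj (coalescence G G' S f))"
      unfolding symmetric_def
    proof (rule symI)
      fix u v assume "(u, v) \<in> arcs_ends (with_proj (coalescence G G' S f))"
      then consider a b where "(a, b) \<in> parcs G" "u = Inl a" "v = Inl b"
        | a b where "(a, b) \<in> parcs G'" "u = glue S f a" "v = glue S f b"
        by (auto simp: coalescence_def)
      then show "(v, u) \<in> arcs_ends (with_proj (coalescence G G' S f))"
      proof cases
        case 1
        from 1 sym[OF 1(1)] show ?thesis by (force simp: coalescence_def)
      next
        case 2
        from 2 sym'[OF 2(1)] show ?thesis by (force simp: coalescence_def)
      qed
    qed
  next
    fix e assume "e \<in> parcs (coalescence G G' S f)"
    then consider a b where "(a, b) \<in> parcs G" "e = (Inl a, Inl b)"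
      | a b where "(a, b) \<in> parcs G'" "e = (glue S f a, glue S f b)"
      by (auto simp: coalescence_def)
    note e_cases = this
    show "fst e \<in> pverts (coalescence G G' S f)"
      using e_cases by cases (auto simp: coalescence_def G.in_arcsD1 G'.in_arcsD1)
    show "snd e \<in> pverts (coalescence G G' S f)"
      using e_cases by cases (auto simp: coalescence_def G.in_arcsD2 G'.in_arcsD2)
    show "fst e \<noteq> snd e"
      using e_cases
    proof cases
      case 1
      with G.pair_no_loops[OF 1(1)] show ?thesis by simp
    next
      case 2
      with G'.pair_no_loops[OF 2(1)] show ?thesis by (simp add: inj)
    qed
  qed (simp_all add: coalescence_def G.pair_finite_verts G'.pair_finite_verts
      G.pair_finite_arcs G'.pair_finite_arcs)
qed

lemma verts_inter_coalescence:
  assumes "clique_matching k G G' S f"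
  shows "Inl ` pverts G \<inter> glue S f ` pverts G' = Inl ` S"
proof -
  have inj: "inj_on f S" and S: "S \<subseteq> pverts G" "f ` S \<subseteq> pverts G'"
    using assms by (auto simp: clique_matching_def)
  have "Inl s \<in> glue S f ` pverts G'" if "s \<in> S" for s
  proof (rule image_eqI)
    show "Inl s = glue S f (f s)"
      using that inj by (simp add: glue_def the_inv_into_f_f)
    show "f s \<in> pverts G'" using that S by auto
  qed
  then have "Inl ` S \<subseteq> Inl ` pverts G \<inter> glue S f ` pverts G'" using S(1) by blast
  moreover have "x \<in> S" if "Inl x = glue S f y" for x y
    using that the_inv_into_into[OF inj, of y S] by (simp add: glue_def split: if_splits)
  then have "Inl ` pverts G \<inter> glue S f ` pverts G' \<subseteq> Inl ` S" by blast
  ultimately show ?thesis by (intro equalityI)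
qed

lemma card_verts_coalescence:
  assumes "clique_matching k G G' S f" "finite (pverts G)" "finite (pverts G')"
  shows "card (pverts (coalescence G G' S f)) + k = card (pverts G) + card (pverts G')"
proof -
  have "card S = k" and inj: "inj_on f S"
    using assms(1) by (auto simp: clique_matching_def complete_digraph_def)
  then show ?thesis
    using card_Un_Int[of "Inl ` pverts G" "glue S f ` pverts G'"] assms(2,3)
    by (simp add: verts_inter_coalescence[OF assms(1)] coalescence_def card_image inj_on_glue)
qed

end

theory Submission
  imports Defs
begin

text \<open>
  The resistance distance can be read off any symmetric \<open>N\<close> with \<open>L N = I - g 1\<^sup>T\<close>: the group
  inverse of \<open>L\<close> is then \<open>P N P\<close>, where \<open>P = I - J / n\<close> is the projection along the constant
  vectors, and \<open>P\<close> fixes \<open>e\<^sub>a - e\<^sub>b\<close>. For two complete graphs glued along \<open>T\<close>, take for the column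
  \<open>N e\<^sub>v\<close> the potential when a unit current enters at \<open>v\<close> and leaves uniformly through \<open>T\<close>. By
  symmetry this potential is supported on the part \<open>T\<close>, \<open>V\<^sub>1 - T\<close> or \<open>V\<^sub>2 - T\<close> that contains \<open>v\<close>.
\<close>

section \<open>Group inverses and resistance distances from uncentred potentials\<close>

text \<open>Entrywise, \<open>X\<close> is \<open>P N P\<close> with \<open>P = I - J / n\<close>,
  and \<open>m\<close> holds the row means of \<open>N\<close>. The rows of \<open>A\<close> sum to
  0, so \<open>A P = A\<close>, and \<open>P\<close> annihilates the rank-one term in
  \<open>g\<close>; hence \<open>A X = P\<close>. By symmetry also \<open>X A = P\<close>, and
  \<open>P\<close> fixes \<open>A\<close> and \<open>X\<close> because their columns sum to
  0.\<close>

lemma is_group_inverse_centred: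
  fixes A N :: "'a \<Rightarrow> 'a \<Rightarrow> real"
  assumes V: "finite V" "V \<noteq> {}"
    and A_sym: "\<And>u v. u \<in> V \<Longrightarrow> v \<in> V \<Longrightarrow> A u v = A v u"
    and A_sum: "\<And>u. u \<in> V \<Longrightarrow> (\<Sum>v\<in>V. A u v) = 0"
    and N_sym: "\<And>u v. u \<in> V \<Longrightarrow> v \<in> V \<Longrightarrow> N u v = N v u"
    and AN: "\<And>u v. u \<in> V \<Longrightarrow> v \<in> V \<Longrightarrow> (\<Sum>w\<in>V. A u w * N w v) = of_bool (u = v) - g u"
  defines "m \<equiv> \<lambda>u. (\<Sum>v\<in>V. N u v) / card V"
  defines "X \<equiv> \<lambda>u v. if u \<in> V \<and> v \<in> V
    then N u v - m u - m v + (\<Sum>w\<in>V. m w) / card V else 0"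
  shows "is_group_inverse V A X"
proof -
  define n where "n = real (card V)"
  have n: "n \<noteq> 0" using V by (simp add: n_def)
  define M where "M = (\<Sum>w\<in>V. m w) / n"
  have X: "X u v = N u v - m u - m v + M" if "u \<in> V" "v \<in> V" for u v
    using that by (simp add: X_def M_def n_def)
  have X_sym: "X u v = X v u" for u v
    using N_sym[of u v] by (auto simp: X_def)
  have sum_N: "(\<Sum>w\<in>V. N u w) = n * m u" for u
    using n by (simp add: m_def n_def)
  have X_sum: "(\<Sum>v\<in>V. X u v) = 0" if "u \<in> V" for u
  proof -
    have "(\<Sum>v\<in>V. X u v) = (\<Sum>v\<in>V. N u v - m u - m v + M)"
      using that by (intro sum.cong) (auto simp: X)
    also have "\<dots> = n * m u - n * m u - (\<Sum>w\<in>V. m w) + n * M"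
      by (simp add: sum.distrib sum_subtractf sum_N n_def)
    also have "\<dots> = 0" using n by (simp add: M_def)
    finally show ?thesis .
  qed
  \<comment> \<open>As \<open>m\<close> is \<open>N\<close> applied to the constant
    \<open>1 / n\<close>, the sink term \<open>g u\<close> reappears here and cancels the one in
    \<open>AN\<close> when \<open>A X\<close> is computed.\<close>
  have Am: "(\<Sum>w\<in>V. A u w * m w) = 1 / n - g u" if u: "u \<in> V" for u
  proof -
    have "(\<Sum>w\<in>V. A u w * m w) = (\<Sum>w\<in>V. \<Sum>v\<in>V. A u w * N w v) / n"
      by (simp add: m_def n_def sum_divide_distrib sum_distrib_left)
    also have "\<dots> = (\<Sum>v\<in>V. \<Sum>w\<in>V. A u w * N w v) / n"
      by (subst sum.swap) simp
    also have "\<dots> = (\<Sum>v\<in>V. of_bool (u = v) - g u) / n"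
      using u AN by simp
    also have "\<dots> = (1 - n * g u) / n"
      using u V by (simp add: sum_subtractf n_def of_bool_def)
    finally show ?thesis using n by (simp add: field_simps)
  qed
  have AX: "matmul_on V A X u v = of_bool (u = v) - 1 / n" if uv: "u \<in> V" "v \<in> V" for u v
  proof -
    have "matmul_on V A X u v = (\<Sum>w\<in>V. A u w * N w v - A u w * m w + A u w * (M - m v))"
      unfolding matmul_on_def using uv by (intro sum.cong) (auto simp: X algebra_simps)
    also have "\<dots> = of_bool (u = v) - g u - (1 / n - g u) + (\<Sum>w\<in>V. A u w) * (M - m v)"
      by (simp only: sum.distrib sum_subtractf AN[OF uv] Am[OF uv(1)] sum_distrib_right)
    finally show ?thesis using A_sum[OF uv(1)] by simp
  qed
  have XA: "matmul_on V X A u v = of_bool (u = v) - 1 / n" if uv: "u \<in> V" "v \<in> V" for u v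
  proof -
    have "matmul_on V X A u v = matmul_on V A X v u"
      unfolding matmul_on_def using uv by (intro sum.cong) (auto simp: X_sym[of u] A_sym mult.commute)
    then show ?thesis using AX[OF uv(2,1)] by (simp add: eq_commute)
  qed
  have proj: "matmul_on V (\<lambda>u v. of_bool (u = v) - 1 / n) Z u v = Z u v"
    if u: "u \<in> V" and Z: "(\<Sum>w\<in>V. Z w v) = 0" for Z :: "'a \<Rightarrow> 'a \<Rightarrow> real" and u v
  proof -
    have "matmul_on V (\<lambda>u v. of_bool (u = v) - 1 / n) Z u v
      = (\<Sum>w\<in>V. if u = w then Z w v else 0) - (\<Sum>w\<in>V. Z w v) / n"
      unfolding matmul_on_def sum_divide_distrib sum_subtractf[symmetric]
      by (intro sum.cong) (auto simp: algebra_simps)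
    then show ?thesis using u V Z by simp
  qed
  show ?thesis
    unfolding is_group_inverse_def
  proof (intro conjI allI ballI impI)
    fix u v assume "u \<notin> V \<or> v \<notin> V"
    then show "X u v = 0" by (auto simp: X_def)
  next
    fix u v assume uv: "u \<in> V" "v \<in> V"
    have "(\<Sum>w\<in>V. A w v) = 0"
      using A_sum[OF uv(2)] uv(2) by (simp add: A_sym[of _ v])
    moreover have "matmul_on V (matmul_on V A X) A u v
      = matmul_on V (\<lambda>u v. of_bool (u = v) - 1 / n) A u v"
      by (rule matmul_on_cong) (simp_all add: AX uv)
    ultimately show "matmul_on V (matmul_on V A X) A u v = A u v"
      using proj[of u A v] uv by simp
    have "(\<Sum>w\<in>V. X w v) = 0"
      using X_sum[OF uv(2)] by (simp add: X_sym[of _ v])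
    moreover have "matmul_on V (matmul_on V X A) X u v
      = matmul_on V (\<lambda>u v. of_bool (u = v) - 1 / n) X u v"
      by (rule matmul_on_cong) (simp_all add: XA uv)
    ultimately show "matmul_on V (matmul_on V X A) X u v = X u v"
      using proj[of u X v] uv by simp
    show "matmul_on V A X u v = matmul_on V X A u v"
      by (simp add: AX XA uv)
  qed
qed

text \<open>The corrections that turn \<open>N\<close> into the group inverse have the form
  \<open>- m u - m v + c\<close>, and these cancel in \<open>X a a + X b b - 2 * X a b\<close>. So
  \<open>N\<close> itself may be used without centring.\<close>

lemma (in graph) resistance_distance_eq:
  assumes N_sym: "\<And>u v. u \<in> verts G \<Longrightarrow> v \<in> verts G \<Longrightarrow> N u v = N v u"
    and LN: "\<And>u v. u \<in> verts G \<Longrightarrow> v \<in> verts G \<Longrightarrow>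
      (\<Sum>w | u \<rightarrow>\<^bsub>G\<^esub> w. N u v - N w v) = of_bool (u = v) - g u"
    and ab: "a \<in> verts G" "b \<in> verts G"
  shows "resistance_distance G a b = N a a + N b b - 2 * N a b"
proof -
  have "(\<Sum>v\<in>verts G. laplacian G u v) = 0" if "u \<in> verts G" for u
    using laplacian_apply[OF that, of "\<lambda>_. 1"] by simp
  moreover have "(\<Sum>w\<in>verts G. laplacian G u w * N w v) = of_bool (u = v) - g u"
    if "u \<in> verts G" "v \<in> verts G" for u v
    using that LN laplacian_apply[of u "\<lambda>w. N w v"] by simp
  moreover have "verts G \<noteq> {}" using ab by auto
  ultimately have X: "is_group_inverse (verts G) (laplacian G)
    (\<lambda>u v. if u \<in> verts G \<and> v \<in> verts G
      then N u v - (\<Sum>v\<in>verts G. N u v) / card (verts G) - (\<Sum>u\<in>verts G. N v u) / card (verts G)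
        + (\<Sum>w\<in>verts G. (\<Sum>v\<in>verts G. N w v) / card (verts G)) / card (verts G) else 0)"
    using finite_verts laplacian_sym N_sym by (intro is_group_inverse_centred[where g = g]) blast+
  show ?thesis
    unfolding resistance_distance_def group_inverse_eqI[OF finite_verts X] Let_def
    using ab by simp
qed

section \<open>Potentials on two cliques with a common part\<close>

text \<open>Block diagonal, with \<open>T = V1 \<inter> V2\<close> as one block. On
  \<open>V1 - V2\<close> the Laplacian block is \<open>card V1 * I - J\<close>, with inverse
  \<open>(I + J / k) / card V1\<close>; likewise on \<open>V2 - V1\<close>. On \<open>T\<close> the
  block \<open>card (V1 \<union> V2) * I - J\<close> is singular only if \<open>T\<close> is
  everything, and \<open>I - J / k\<close> has zero column sums, so dividing by
  \<open>card (V1 \<union> V2)\<close> suffices.\<close>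

definition clique_pair_kernel :: "'a set \<Rightarrow> 'a set \<Rightarrow> 'a \<Rightarrow> 'a \<Rightarrow> real" where
  "clique_pair_kernel V1 V2 u v =
    (let k = real (card (V1 \<inter> V2)) in
     if u \<in> V1 \<inter> V2 \<and> v \<in> V1 \<inter> V2 then (of_bool (u = v) - 1 / k) / card (V1 \<union> V2)
     else if u \<in> V1 - V2 \<and> v \<in> V1 - V2 then (of_bool (u = v) + 1 / k) / card V1
     else if u \<in> V2 - V1 \<and> v \<in> V2 - V1 then (of_bool (u = v) + 1 / k) / card V2
     else 0)"

lemma sum_of_bool_eq_plus_const:
  fixes c d :: real
  assumes "finite A" "v \<in> A"
  shows "(\<Sum>u\<in>A. (of_bool (u = v) + c) / d) = (1 + card A * c) / d"
  using assms by (simp add: sum_divide_distrib[symmetric] sum.distrib of_bool_def)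

text \<open>The closed neighbourhood of every vertex is \<open>V1\<close>, \<open>V2\<close> or
  their union, so the current balance at a vertex needs only the column sums of \<open>N\<close>
  over these three sets.\<close>

lemma (in graph) resistance_distance_clique_pair:
  assumes V: "verts G = V1 \<union> V2" and ne: "V1 \<inter> V2 \<noteq> {}"
    and adj: "\<And>u v. u \<rightarrow>\<^bsub>G\<^esub> v \<longleftrightarrow> u \<noteq> v \<and> (u \<in> V1 \<and> v \<in> V1 \<or> u \<in> V2 \<and> v \<in> V2)"
    and ab: "a \<in> V1 \<union> V2" "b \<in> V1 \<union> V2"
  defines "N \<equiv> clique_pair_kernel V1 V2"
  shows "resistance_distance G a b = N a a + N b b - 2 * N a b"
proof -
  let ?T = "V1 \<inter> V2" and ?A = "V1 - V2" and ?B = "V2 - V1"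
  define k where "k = real (card ?T)"
  have fin: "finite V1" "finite V2" using finite_verts V by auto
  have k: "k > 0" using ne fin by (simp add: k_def card_gt_0_iff)
  have cA: "real (card V1) = k + card ?A"
    unfolding k_def using fin card_Un_disjoint[of ?T ?A] by (simp add: Int_Diff_Un Int_Diff_disjoint)
  have cB: "real (card V2) = k + card ?B"
    unfolding k_def using fin card_Un_disjoint[of ?T ?B]
    by (simp add: Int_Diff_Un Int_Diff_disjoint Int_commute[of V1])
  have pos: "real (card V1) > 0" "real (card V2) > 0" "real (card (V1 \<union> V2)) > 0"
    using ne fin by (auto simp: card_gt_0_iff)
  note N_def' = N_def clique_pair_kernel_def Let_def k_def[symmetric]
  have sT: "(\<Sum>u\<in>?T. N u v) = 0" for v
  proof (cases "v \<in> ?T")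
    case True
    then have "(\<Sum>u\<in>?T. N u v) = (\<Sum>u\<in>?T. (of_bool (u = v) + - (1 / k)) / card (V1 \<union> V2))"
      by (intro sum.cong) (auto simp: N_def')
    also have "\<dots> = (1 + card ?T * - (1 / k)) / card (V1 \<union> V2)"
      using True fin by (intro sum_of_bool_eq_plus_const) auto
    finally show ?thesis using k by (simp add: k_def)
  qed (auto simp: N_def' intro!: sum.neutral)
  have sA: "(\<Sum>u\<in>?A. N u v) = (if v \<in> ?A then 1 / k else 0)" for v
  proof (cases "v \<in> ?A")
    case True
    then have "(\<Sum>u\<in>?A. N u v) = (\<Sum>u\<in>?A. (of_bool (u = v) + 1 / k) / card V1)"
      by (intro sum.cong) (auto simp: N_def')
    also have "\<dots> = (1 + card ?A * (1 / k)) / card V1"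
      using True fin by (intro sum_of_bool_eq_plus_const) auto
    also have "1 + card ?A * (1 / k) = card V1 / k"
      using k by (simp add: cA field_simps)
    finally show ?thesis using True pos by simp
  qed (auto simp: N_def' intro!: sum.neutral)
  have sB: "(\<Sum>u\<in>?B. N u v) = (if v \<in> ?B then 1 / k else 0)" for v
  proof (cases "v \<in> ?B")
    case True
    then have "(\<Sum>u\<in>?B. N u v) = (\<Sum>u\<in>?B. (of_bool (u = v) + 1 / k) / card V2)"
      by (intro sum.cong) (auto simp: N_def')
    also have "\<dots> = (1 + card ?B * (1 / k)) / card V2"
      using True fin by (intro sum_of_bool_eq_plus_const) auto
    also have "1 + card ?B * (1 / k) = card V2 / k"
      using k by (simp add: cB field_simps)
    finally show ?thesis using True pos by simp
  qed (auto simp: N_def' intro!: sum.neutral)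
  have s1: "(\<Sum>u\<in>V1. N u v) = (if v \<in> ?A then 1 / k else 0)" for v
    using sum.Int_Diff[OF fin(1), of "\<lambda>u. N u v" V2] by (simp add: sT sA)
  have s2: "(\<Sum>u\<in>V2. N u v) = (if v \<in> ?B then 1 / k else 0)" for v
    using sum.Int_Diff[OF fin(2), of "\<lambda>u. N u v" V1] by (simp add: sT sB Int_commute[of V2])
  \<comment> \<open>The overlap \<open>T\<close> is counted twice in the sums over \<open>V1\<close>
    and \<open>V2\<close>, but contributes 0 by \<open>sT\<close>.\<close>
  have s12: "(\<Sum>u\<in>V1 \<union> V2. N u v) = (if v \<in> ?T then 0 else 1 / k)" if "v \<in> V1 \<union> V2" for v
    using sum.union_inter[OF fin, of "\<lambda>u. N u v"] that by (auto simp: sT s1 s2)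
  \<comment> \<open>The summand at \<open>w = u\<close> vanishes, so the sum may run over the whole
    clique.\<close>
  have nbr: "(\<Sum>w\<in>C - {u}. N u v - N w v) = card C * N u v - (\<Sum>w\<in>C. N w v)"
    if "finite C" for C u v
    using that by (subst sum_diff1) (auto simp: sum_subtractf)
  show ?thesis
  \<comment> \<open>The sink draws \<open>1 / k\<close> at each vertex of \<open>T\<close>, a unit
    current in total.\<close>
  proof (rule resistance_distance_eq[where g = "\<lambda>u. of_bool (u \<in> ?T) / k"])
    show "N u v = N v u" for u v
      by (auto simp: N_def clique_pair_kernel_def Let_def)
    show "a \<in> verts G" "b \<in> verts G" using ab V by auto
    fix u v assume uv: "u \<in> verts G" "v \<in> verts G"
    then consider "u \<in> ?T" | "u \<in> ?A" | "u \<in> ?B" using V by blast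
    then show "(\<Sum>w | u \<rightarrow>\<^bsub>G\<^esub> w. N u v - N w v) = of_bool (u = v) - of_bool (u \<in> ?T) / k"
    proof cases
      case 1
      then have "{w. u \<rightarrow>\<^bsub>G\<^esub> w} = (V1 \<union> V2) - {u}" by (auto simp: adj)
      moreover have "(\<Sum>w\<in>V1 \<union> V2. N w v) = (if v \<in> ?T then 0 else 1 / k)"
        using uv V s12 by simp
      ultimately have "(\<Sum>w | u \<rightarrow>\<^bsub>G\<^esub> w. N u v - N w v)
        = card (V1 \<union> V2) * N u v - (if v \<in> ?T then 0 else 1 / k)"
        using fin by (simp only: nbr finite_Un)
      \<comment> \<open>The \<open>- 1 / k\<close> comes from the kernel entry if \<open>v\<close>
        is in \<open>T\<close>, and from the column sum otherwise.\<close>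
      then show ?thesis using 1 uv pos k V
        by (cases "v \<in> ?T") (auto simp: N_def')
    next
      case 2
      then have "{w. u \<rightarrow>\<^bsub>G\<^esub> w} = V1 - {u}" by (auto simp: adj)
      moreover have "(\<Sum>w\<in>V1. N w v) = (if v \<in> ?A then 1 / k else 0)"
        using uv V s1 by simp
      ultimately have "(\<Sum>w | u \<rightarrow>\<^bsub>G\<^esub> w. N u v - N w v)
        = card V1 * N u v - (if v \<in> ?A then 1 / k else 0)"
        using fin by (simp only: nbr finite_Un)
      \<comment> \<open>Outside \<open>T\<close> there is no sink: for \<open>v\<close> in the same
        block the column sum removes the \<open>1 / k\<close> of the kernel entry, and otherwise
        both terms are 0.\<close>
      then show ?thesis using 2 uv pos k V
        by (cases "v \<in> ?A") (auto simp: N_def')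
    next
      case 3
      then have "{w. u \<rightarrow>\<^bsub>G\<^esub> w} = V2 - {u}" by (auto simp: adj)
      moreover have "(\<Sum>w\<in>V2. N w v) = (if v \<in> ?B then 1 / k else 0)"
        using uv V s2 by simp
      ultimately have "(\<Sum>w | u \<rightarrow>\<^bsub>G\<^esub> w. N u v - N w v)
        = card V2 * N u v - (if v \<in> ?B then 1 / k else 0)"
        using fin by (simp only: nbr finite_Un)
      then show ?thesis using 3 uv pos k V
        by (cases "v \<in> ?B") (auto simp: N_def')
    qed
  qed
qed

section \<open>Resistance distances in the coalescence of two complete graphs\<close>

theorem theorem3p1:
  fixes G1 :: "'a pair_pre_digraph" and G2 :: "'b pair_pre_digraph"
    and S :: "'a set" and f :: "'a \<Rightarrow> 'b" and k p1 p2 :: nat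
  assumes "k \<ge> 1" and "p1 \<ge> k" and "p2 \<ge> k"
    and "K\<^bsub>p1\<^esub> (with_proj G1)" and "K\<^bsub>p2\<^esub> (with_proj G2)"
    and "clique_matching k G1 G2 S f"
  defines "H \<equiv> coalescence G1 G2 S f"
    and "V1 \<equiv> Inl ` pverts G1" and "V2 \<equiv> glue S f ` pverts G2" and "T \<equiv> Inl ` S"
  defines "r \<equiv> resistance_distance (with_proj H)"
    and "t \<equiv> real p1 + real p2 - real k"
  shows "(real (card (pverts H)) = t) \<and>
    (\<forall>i\<in>T. \<forall>j\<in>T. i \<noteq> j \<longrightarrow> r i j = 2 / t) \<and>
    (\<forall>i\<in>T. \<forall>j\<in>V1 - T.
           r i j = ((real k + 1) * (real p2 - real k) + 2 * real p1 * real k) / (real k * real p1 * t)) \<and>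
    (\<forall>i\<in>T. \<forall>j\<in>V2 - T.
           r i j = ((real k + 1) * (real p1 - real k) + 2 * real p2 * real k) / (real k * real p2 * t)) \<and>
    (\<forall>i\<in>V1 - T. \<forall>j\<in>V1 - T. i \<noteq> j \<longrightarrow> r i j = 2 / real p1) \<and>
    (\<forall>i\<in>V1 - T. \<forall>j\<in>V2 - T.
           r i j = (real p1 + real p2) * (real k + 1) / (real k * real p1 * real p2)) \<and>
    (\<forall>i\<in>V2 - T. \<forall>j\<in>V2 - T. i \<noteq> j \<longrightarrow> r i j = 2 / real p2)"
proof -
  interpret G1: pair_graph G1 by (rule pair_graphI_complete) fact
  interpret G2: pair_graph G2 by (rule pair_graphI_complete) fact
  have S: "inj_on f S" "card S = k"
    using assms(6) by (auto simp: clique_matching_def complete_digraph_def)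
  interpret H: pair_graph H
    unfolding H_def by (rule pair_graph_coalescence) (use S in auto)
  note G1 = assms(4)[unfolded complete_digraph_pair_def]
    and G2 = assms(5)[unfolded complete_digraph_pair_def]
  have V: "pverts H = V1 \<union> V2"
    by (simp add: H_def V1_def V2_def coalescence_def)
  have T: "V1 \<inter> V2 = T"
    unfolding V1_def V2_def T_def by (rule verts_inter_coalescence) fact
  have cT: "card (V1 \<inter> V2) = k"
    using S by (simp add: T T_def card_image)
  have c1: "card V1 = p1"
    using G1 by (simp add: V1_def card_image)
  have c2: "card V2 = p2"
    using G2 S by (simp add: V2_def card_image inj_on_glue)
  have c12: "real (card (V1 \<union> V2)) = t"
    using card_verts_coalescence[OF assms(6)] G1 G2 by (simp add: t_def V[symmetric] H_def)
  have inj: "glue S f x = glue S f y \<longleftrightarrow> x = y" for x y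
    using inj_on_glue[OF S(1), of UNIV] by (simp add: inj_eq)
  \<comment> \<open>The coalescence is a pair of cliques on \<open>V1\<close> and \<open>V2\<close>;
    injectivity of \<open>glue S f\<close> keeps distinct vertices of \<open>G2\<close>
    distinct.\<close>
  have adj: "(u, v) \<in> parcs H \<longleftrightarrow> u \<noteq> v \<and> (u \<in> V1 \<and> v \<in> V1 \<or> u \<in> V2 \<and> v \<in> V2)" for u v
    using G1 G2 by (auto simp: H_def coalescence_def V1_def V2_def inj)
  have ne: "V1 \<inter> V2 \<noteq> {}" using cT assms(1) by auto
  define N where "N = clique_pair_kernel V1 V2"
  have r: "r i j = N i i + N j j - 2 * N i j" if "i \<in> V1 \<union> V2" "j \<in> V1 \<union> V2" for i j
    unfolding r_def N_def
    by (rule graph.resistance_distance_clique_pair[OF H.pair_graphD_graph _ ne])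
      (use that in \<open>simp_all add: V adj\<close>)
  have pos: "real k > 0" "real p1 > 0" "real p2 > 0" "t > 0"
    using assms(1-3) by (auto simp: t_def)
  note N_def' = N_def clique_pair_kernel_def Let_def cT c1 c2 c12
  have NT: "N i i = (1 - 1 / k) / t" if "i \<in> T" for i
    using that T by (auto simp: N_def')
  have N1: "N i i = (1 + 1 / k) / p1" if "i \<in> V1 - T" for i
    using that T by (auto simp: N_def')
  have N2: "N i i = (1 + 1 / k) / p2" if "i \<in> V2 - T" for i
    using that T by (auto simp: N_def')
  show ?thesis
  proof (intro conjI ballI impI)
    show "real (card (pverts H)) = t" by (simp add: V c12)
    fix i j assume i: "i \<in> T" and j: "j \<in> T" and ij: "i \<noteq> j"
    then have "N i j = - (1 / k) / t" using T by (auto simp: N_def')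
    then have "r i j = (1 - 1 / k) / t + (1 - 1 / k) / t - 2 * (- (1 / k) / t)"
      using i j T by (subst r) (auto simp: NT)
    then show "r i j = 2 / t" using pos by (simp add: field_simps)
  next
    fix i j assume i: "i \<in> T" and j: "j \<in> V1 - T"
    \<comment> \<open>Different blocks do not interact, so a mixed distance is the sum of two
      diagonal entries.\<close>
    then have "N i j = 0" using T by (auto simp: N_def')
    then have "r i j = (1 - 1 / k) / t + (1 + 1 / k) / p1"
      using i j T by (subst r) (auto simp: NT N1)
    also have "\<dots> = ((real k - 1) * p1 + (real k + 1) * t) / (k * p1 * t)"
      using pos by (simp add: field_simps)
    \<comment> \<open>Splitting \<open>t\<close> as \<open>p1 + (p2 - k)\<close> collects the terms
      in \<open>p1\<close> into \<open>2 * p1 * k\<close>.\<close>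
    also have "(real k - 1) * p1 + (real k + 1) * t
        = (real k + 1) * (real p2 - real k) + 2 * real p1 * real k"
      by (simp add: t_def algebra_simps)
    finally show "r i j
      = ((real k + 1) * (real p2 - real k) + 2 * real p1 * real k) / (real k * real p1 * t)" by simp
  next
    fix i j assume i: "i \<in> T" and j: "j \<in> V2 - T"
    then have "N i j = 0" using T by (auto simp: N_def')
    then have "r i j = (1 - 1 / k) / t + (1 + 1 / k) / p2"
      using i j T by (subst r) (auto simp: NT N2)
    also have "\<dots> = ((real k - 1) * p2 + (real k + 1) * t) / (k * p2 * t)"
      using pos by (simp add: field_simps)
    also have "(real k - 1) * p2 + (real k + 1) * t
        = (real k + 1) * (real p1 - real k) + 2 * real p2 * real k"
      by (simp add: t_def algebra_simps)
    finally show "r i j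
      = ((real k + 1) * (real p1 - real k) + 2 * real p2 * real k) / (real k * real p2 * t)" by simp
  next
    fix i j assume i: "i \<in> V1 - T" and j: "j \<in> V1 - T" and ij: "i \<noteq> j"
    then have "N i j = (1 / k) / p1" using T by (auto simp: N_def')
    then have "r i j = (1 + 1 / k) / p1 + (1 + 1 / k) / p1 - 2 * ((1 / k) / p1)"
      using i j by (subst r) (auto simp: N1)
    then show "r i j = 2 / real p1" using pos by (simp add: field_simps)
  next
    fix i j assume i: "i \<in> V1 - T" and j: "j \<in> V2 - T"
    then have "N i j = 0" using T by (auto simp: N_def')
    \<comment> \<open>Here the two diagonal entries add up to
      \<open>(1 + 1 / k) * (1 / p1 + 1 / p2)\<close>.\<close>
    then show "r i j = (real p1 + real p2) * (real k + 1) / (real k * real p1 * real p2)"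
      using i j pos by (subst r) (auto simp: N1 N2 field_simps)
  next
    fix i j assume i: "i \<in> V2 - T" and j: "j \<in> V2 - T" and ij: "i \<noteq> j"
    then have "N i j = (1 / k) / p2" using T by (auto simp: N_def')
    then have "r i j = (1 + 1 / k) / p2 + (1 + 1 / k) / p2 - 2 * ((1 / k) / p2)"
      using i j by (subst r) (auto simp: N2)
    then show "r i j = 2 / real p2" using pos by (simp add: field_simps)
  qed
qed

end
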